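(* Let $\hbar>0$ and let $H:T^*\mathbb{R}^n\to\mathbb{R}$ be smooth. Let $\mathcal{O}\subset\mathfrak{sp}(2n,\mathbb{R})$ be the adjoint orbit of $\mathrm{Sp}(2n,\mathbb{R})$ through $-\mathbb{J}$. Put $H^\hbar(z,E)=H(z)+\frac{\hbar}{4}\operatorname{Tr}(E^\top D^2_zH\,E)$ on $T^*\mathbb{R}^n\times\mathrm{GL}(2n,\mathbb{R})$ and $\check H^\hbar(z,\zeta)=H(z)+\frac{\hbar}{4}\operatorname{Tr}(\zeta\,\mathbb{J}D^2_zH)$ on $T^*\mathbb{R}^n\times\mathcal{O}$. On $T^*\mathbb{R}^n\times\mathrm{Sp}(2n,\mathbb{R})$ one has $H^\hbar=\check H^\hbar\circ(\mathrm{id}\times j_{\mathrm{Sp}})$, and the Hamiltonian vector fields $$X_{H^\hbar}(z,E)=\left(X_{H+\frac{\hbar}{4}\Delta_{g(E)}H}(z),\ \mathbb{J}D^2_zH\,E\right),\qquad X_{\check H^\hbar}(z,\zeta)=\left(X_{H+\frac{\hbar}{4}\Delta_{\check g(\zeta)}H}(z),\ [\mathbb{J}D^2_zH,\zeta]\right)$$ are $(\mathrm{id}\times j_{\mathrm{Sp}})$-related: $$T(\mathrm{id}\times j_{\mathrm{Sp}})\circ X_{H^\hbar}=X_{\check H^\hbar}\circ(\mathrm{id}\times j_{\mathrm{Sp}}).$$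
   Context: $T^*\mathbb{R}^n\simeq\mathbb{R}^{2n}$ has coordinates $z=(q^1,\dots,q^n,p_1,\dots,p_n)$ and symplectic form $\omega=\sum_\alpha dq^\alpha\wedge dp_\alpha$; $D^2_zH$ is the Hessian matrix; $\mathbb{J}=\begin{bmatrix}0_n & I_n\\ -I_n & 0_n\end{bmatrix}$; $j_{\mathrm{Sp}}(E)=-EE^\top\mathbb{J}$, which maps $\mathrm{Sp}(2n,\mathbb{R})=\{E : E^\top\mathbb{J}E=\mathbb{J}\}$ onto $\mathcal{O}$. Hamiltonian vector fields are defined by $i_{X_f}(\text{symplectic form})=df$, with respect to $\omega$ on $T^*\mathbb{R}^n$; to $\Omega^\hbar_{(z,E)}((v,V),(w,W))=\omega_z(v,w)+\frac{\hbar}{2}\operatorname{Tr}(V^\top\mathbb{J}W)$ on $T^*\mathbb{R}^n\times\mathrm{GL}(2n,\mathbb{R})$; and to $\omega\oplus\frac{\hbar}{2}\Omega^+_{\mathcal{O}}$ on $T^*\mathbb{R}^n\times\mathcal{O}$, where $(\Omega^+_{\mathcal{O}})_\eta([\xi,\eta],[\zeta,\eta])=\frac12\operatorname{Tr}(\eta[\xi,\zeta])$. Here $g(E)$ and $\check g(\zeta)$ are the constant metrics on $T^*\mathbb{R}^n$ with matrices $(EE^\top)^{-1}$ and $(\zeta\mathbb{J})^{-1}$ in the coordinates $z_1,\dots,z_{2n}$, so their Laplacians are $\Delta_{g(E)}H=\operatorname{Tr}(E^\top D^2H\,E)$ and $\Delta_{\check g(\zeta)}H=\operatorname{Tr}(\zeta\mathbb{J}D^2H)$.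 In the first components, $E$ (respectively $\zeta$) is held fixed when forming the Hamiltonian vector field on $T^*\mathbb{R}^n$ of the displayed function of $z$. *)

theory Defs
  imports "HOL-Analysis.Analysis"
begin

section \<open>Smooth functions, gradient and Hessian\<close>

primrec C_k :: "nat \<Rightarrow> ('a::real_normed_vector \<Rightarrow> 'b::real_normed_vector) \<Rightarrow> bool" where
  "C_k 0 f \<longleftrightarrow> continuous_on UNIV f"
| "C_k (Suc k) f \<longleftrightarrow>
     (\<forall>x. f differentiable (at x)) \<and> (\<forall>v. C_k k (\<lambda>x. frechet_derivative f (at x) v))"

definition smooth :: "('a::real_normed_vector \<Rightarrow> 'b::real_normed_vector) \<Rightarrow> bool" where
  "smooth f \<longleftrightarrow> (\<forall>k. C_k k f)"

definition partial :: "'m::finite \<Rightarrow> (real^'m \<Rightarrow> real) \<Rightarrow> real^'m \<Rightarrow> real" where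
  "partial i f z = frechet_derivative f (at z) (axis i 1)"

definition hessian :: "(real^'m::finite \<Rightarrow> real) \<Rightarrow> real^'m \<Rightarrow> real^'m^'m" where
  "hessian f z = (\<chi> i j. partial i (partial j f) z)"

text \<open>
  Laplacian, the divergence of the gradient, of the constant metric with Gram matrix \<open>G\<close>.
  The Riemannian volume of such a metric has constant density, so the divergence is the
  Euclidean one.
\<close>

definition gradient :: "real^'m^'m \<Rightarrow> (real^'m::finite \<Rightarrow> real) \<Rightarrow> real^'m \<Rightarrow> real^'m" where
  "gradient G f z = matrix_inv G *v (\<chi> i. partial i f z)"

definition laplacian :: "real^'m^'m \<Rightarrow> (real^'m::finite \<Rightarrow> real) \<Rightarrow> real^'m \<Rightarrow> real" where
  "laplacian G f z = (\<Sum>i\<in>UNIV. partial i (\<lambda>y. gradient G f y $ i) z)"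


section \<open>Tangent vectors, tangent maps and Hamiltonian vector fields\<close>

text \<open>
  All manifolds here are embedded submanifolds \<open>M\<close> of a normed space. For these, the
  velocities at \<open>x\<close> of curves in \<open>M\<close> that are merely differentiable at the base point already
  make up exactly \<open>T\<^sub>x M\<close>.
\<close>

definition curve_at ::
  "'a::real_normed_vector set \<Rightarrow> 'a \<Rightarrow> 'a \<Rightarrow> (real \<Rightarrow> 'a) \<Rightarrow> bool" where
  "curve_at M x v \<gamma> \<longleftrightarrow>
     \<gamma> 0 = x \<and> (\<forall>\<^sub>F t in nhds 0. \<gamma> t \<in> M) \<and> (\<gamma> has_vector_derivative v) (at 0)"

definition tangent_space :: "'a::real_normed_vector set \<Rightarrow> 'a \<Rightarrow> 'a set" where
  "tangent_space M x = {v. \<exists>\<gamma>. curve_at M x v \<gamma>}"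

text \<open>\<open>T\<^sub>x f (v) = w\<close>, for \<open>v\<close> in \<open>T\<^sub>x M\<close>. Only the values of \<open>f\<close> on \<open>M\<close> matter.\<close>

definition has_tangent_value ::
  "'a::real_normed_vector set \<Rightarrow> ('a \<Rightarrow> 'b::real_normed_vector) \<Rightarrow> 'a \<Rightarrow> 'a \<Rightarrow> 'b \<Rightarrow> bool" where
  "has_tangent_value M f x v w \<longleftrightarrow>
     (\<forall>\<gamma>. curve_at M x v \<gamma> \<longrightarrow> ((f \<circ> \<gamma>) has_vector_derivative w) (at 0))"

definition tangent_map ::
  "'a::real_normed_vector set \<Rightarrow> ('a \<Rightarrow> 'b::real_normed_vector) \<Rightarrow> 'a \<Rightarrow> 'a \<Rightarrow> 'b" where
  "tangent_map M f x v = (THE w. has_tangent_value M f x v w)"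

text \<open>\<open>X\<close> in \<open>T\<^sub>x M\<close> with \<open>\<Omega>\<^sub>x (X, w) = df\<^sub>x (w)\<close> for all \<open>w\<close> in \<open>T\<^sub>x M\<close>.\<close>

definition is_hamiltonian_vector ::
  "'a::real_normed_vector set \<Rightarrow> ('a \<Rightarrow> 'a \<Rightarrow> 'a \<Rightarrow> real) \<Rightarrow> ('a \<Rightarrow> real) \<Rightarrow> 'a \<Rightarrow> 'a \<Rightarrow> bool" where
  "is_hamiltonian_vector M \<Omega> f x X \<longleftrightarrow>
     X \<in> tangent_space M x \<and>
     (\<forall>w\<in>tangent_space M x. has_tangent_value M f x w (\<Omega> x X w))"

definition has_hamiltonian_vf ::
  "'a::real_normed_vector set \<Rightarrow> ('a \<Rightarrow> 'a \<Rightarrow> 'a \<Rightarrow> real) \<Rightarrow> ('a \<Rightarrow> real) \<Rightarrow> bool" where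
  "has_hamiltonian_vf M \<Omega> f \<longleftrightarrow> (\<forall>x\<in>M. \<exists>!X. is_hamiltonian_vector M \<Omega> f x X)"

definition hamiltonian_vf ::
  "'a::real_normed_vector set \<Rightarrow> ('a \<Rightarrow> 'a \<Rightarrow> 'a \<Rightarrow> real) \<Rightarrow> ('a \<Rightarrow> real) \<Rightarrow> 'a \<Rightarrow> 'a" where
  "hamiltonian_vf M \<Omega> f x = (THE X. is_hamiltonian_vector M \<Omega> f x X)"


section \<open>Phase space and matrix groups\<close>

text \<open>
  The index type \<open>'n + 'n\<close> orders the coordinates as \<open>(q, p)\<close>: \<open>z $ Inl a\<close> is the position
  \<open>q\<^sup>a\<close>, \<open>z $ Inr a\<close> the momentum \<open>p\<^sub>a\<close>, and \<open>n\<close> is \<open>CARD('n)\<close>.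
\<close>

type_synonym 'n phase = "real^('n + 'n)"
type_synonym 'n pmat = "real^('n + 'n)^('n + 'n)"

definition omega :: "'n::finite phase \<Rightarrow> 'n phase \<Rightarrow> real" where
  "omega v w = (\<Sum>a\<in>UNIV. v $ Inl a * w $ Inr a - v $ Inr a * w $ Inl a)"

definition JJ :: "'n::finite pmat" where
  "JJ = (\<chi> i j. case (i, j) of
      (Inl a, Inr b) \<Rightarrow> if a = b then 1 else 0
    | (Inr a, Inl b) \<Rightarrow> if a = b then - 1 else 0
    | _ \<Rightarrow> 0)"

definition commutator :: "'n::finite pmat \<Rightarrow> 'n pmat \<Rightarrow> 'n pmat" where
  "commutator A B = A ** B - B ** A"

definition GL :: "'n::finite pmat set" where
  "GL = {E. invertible E}"

definition Sp :: "'n::finite pmat set" where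
  "Sp = {E. transpose E ** JJ ** E = JJ}"

definition sp_alg :: "'n::finite pmat set" where
  "sp_alg = {\<xi>. transpose \<xi> ** JJ + JJ ** \<xi> = 0}"

definition orbit :: "'n::finite pmat set" where
  "orbit = {E ** (- JJ) ** matrix_inv E | E. E \<in> Sp}"

definition j_Sp :: "'n::finite pmat \<Rightarrow> 'n pmat" where
  "j_Sp E = - (E ** transpose E ** JJ)"


section \<open>Symplectic forms\<close>

text \<open>
  The form on tangent vectors \<open>v = [\<xi>,\<eta>]\<close>, \<open>w = [\<zeta>,\<eta>]\<close> of the orbit; it does not depend on
  the choice of \<open>\<xi>\<close> and \<open>\<zeta>\<close>, see \<open>Omega_orbit_commutator\<close> below.
\<close>

definition Omega_orbit :: "'n::finite pmat \<Rightarrow> 'n pmat \<Rightarrow> 'n pmat \<Rightarrow> real" where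
  "Omega_orbit \<eta> v w = (THE r. \<exists>\<xi>\<in>sp_alg. \<exists>\<zeta>\<in>sp_alg.
     v = commutator \<xi> \<eta> \<and> w = commutator \<zeta> \<eta> \<and> r = 1/2 * trace (\<eta> ** commutator \<xi> \<zeta>))"

definition Omega_GL :: "real \<Rightarrow> 'n::finite phase \<times> 'n pmat \<Rightarrow>
    'n phase \<times> 'n pmat \<Rightarrow> 'n phase \<times> 'n pmat \<Rightarrow> real" where
  "Omega_GL hbar = (\<lambda>(z, E) (v, V) (w, W).
     omega v w + hbar / 2 * trace (transpose V ** JJ ** W))"

definition Omega_prod :: "real \<Rightarrow> 'n::finite phase \<times> 'n pmat \<Rightarrow>
    'n phase \<times> 'n pmat \<Rightarrow> 'n phase \<times> 'n pmat \<Rightarrow> real" where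
  "Omega_prod hbar = (\<lambda>(z, \<zeta>) (v, V) (w, W). omega v w + hbar / 2 * Omega_orbit \<zeta> V W)"


section \<open>Metrics and Hamiltonians\<close>

definition metric_GL :: "'n::finite pmat \<Rightarrow> 'n pmat" where
  "metric_GL E = matrix_inv (E ** transpose E)"

definition metric_orbit :: "'n::finite pmat \<Rightarrow> 'n pmat" where
  "metric_orbit \<zeta> = matrix_inv (\<zeta> ** JJ)"

definition H_GL :: "real \<Rightarrow> ('n::finite phase \<Rightarrow> real) \<Rightarrow> 'n phase \<times> 'n pmat \<Rightarrow> real" where
  "H_GL hbar H = (\<lambda>(z, E). H z + hbar / 4 * trace (transpose E ** hessian H z ** E))"

definition H_orbit :: "real \<Rightarrow> ('n::finite phase \<Rightarrow> real) \<Rightarrow> 'n phase \<times> 'n pmat \<Rightarrow> real" where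
  "H_orbit hbar H = (\<lambda>(z, \<zeta>). H z + hbar / 4 * trace (\<zeta> ** JJ ** hessian H z))"

text \<open>The Hamiltonian vector field of \<open>f\<close> on the phase space itself.\<close>

definition X_phase :: "('n::finite phase \<Rightarrow> real) \<Rightarrow> 'n phase \<Rightarrow> 'n phase" where
  "X_phase f = hamiltonian_vf UNIV (\<lambda>z. omega) f"


section \<open>Consistency of the definitions\<close>

lemma neg_mult_left: "(- A) ** B = - (A ** (B :: real^'m^'m))"
  by (simp add: vec_eq_iff matrix_matrix_mult_def sum_negf)

lemma neg_mult_right: "A ** (- B) = - (A ** (B :: real^'m^'m))"
  by (simp add: vec_eq_iff matrix_matrix_mult_def sum_negf)

lemma mult_diff_left: "(A - B) ** C = A ** C - B ** (C :: real^'m^'m)"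
  by (simp add: vec_eq_iff matrix_matrix_mult_def sum_subtractf left_diff_distrib)

lemma mult_diff_right: "A ** (B - C) = A ** B - A ** (C :: real^'m^'m)"
  by (simp add: vec_eq_iff matrix_matrix_mult_def sum_subtractf right_diff_distrib)

lemma trace_neg: "trace (- A) = - trace (A :: real^'m^'m)"
  by (simp add: trace_def sum_negf)

lemma sum_UNIV_Plus:
  "(\<Sum>i\<in>UNIV. f i) = (\<Sum>a\<in>UNIV. f (Inl (a::'n::finite))) + (\<Sum>b\<in>UNIV. f (Inr (b::'n)) :: real)"
  by (simp add: UNIV_Plus_UNIV[symmetric] sum.Plus del: UNIV_Plus_UNIV)

lemma JJ_square: "JJ ** JJ = - (mat 1 :: 'n::finite pmat)"
proof -
  have "(JJ ** JJ) $ i $ j = (- (mat 1 :: 'n pmat)) $ i $ j" for i j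
    by (cases i; cases j)
      (auto simp: JJ_def matrix_matrix_mult_def mat_def sum_UNIV_Plus if_distrib
        if_distribR cong: if_cong intro!: sum.neutral)
  then show ?thesis
    by (simp add: vec_eq_iff)
qed

lemma omega_JJ: "omega v w = v \<bullet> (JJ *v w)"
  by (simp add: omega_def JJ_def inner_vec_def matrix_vector_mult_def sum_UNIV_Plus
      if_distrib[of "\<lambda>x. x * _"] sum_subtractf sum_negf cong: if_cong)

lemma Sp_inverse:
  assumes "E \<in> Sp"
  shows "E ** (- (JJ ** transpose E ** JJ)) = mat 1" and "matrix_inv E = - (JJ ** transpose E ** JJ)"
proof -
  let ?F = "- (JJ ** transpose E ** JJ)"
  have "JJ ** (transpose E ** JJ ** E) = - mat 1"
    using assms by (simp add: Sp_def JJ_square)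
  then have FE: "?F ** E = mat 1"
    by (simp add: neg_mult_left matrix_mul_assoc)
  then show EF: "E ** ?F = mat 1"
    by (simp add: matrix_left_right_inverse)
  have "invertible E"
    using EF FE by (auto simp: invertible_def)
  then have "matrix_inv E ** E = mat 1"
    unfolding matrix_inv_def invertible_def by (rule someI2_ex) simp
  then have "matrix_inv E ** (E ** ?F) = ?F"
    by (simp only: matrix_mul_assoc matrix_mul_lid)
  then show "matrix_inv E = ?F"
    by (simp only: EF matrix_mul_rid)
qed

lemma j_Sp_conjugation:
  assumes "E \<in> Sp"
  shows "j_Sp E = E ** (- JJ) ** matrix_inv E"
proof -
  have "E ** (- JJ) ** matrix_inv E = E ** ((JJ ** JJ) ** transpose E ** JJ)"
    by (simp add: Sp_inverse[OF assms] neg_mult_left neg_mult_right matrix_mul_assoc)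
  also have "\<dots> = j_Sp E"
    by (simp add: JJ_square j_Sp_def neg_mult_left neg_mult_right matrix_mul_assoc)
  finally show ?thesis ..
qed

lemma j_Sp_image: "j_Sp ` Sp = orbit"
  by (auto simp: orbit_def j_Sp_conjugation image_iff)

lemma trace_commutator: "trace (A ** commutator B C) = - trace (commutator B A ** C)"
proof -
  have "trace (A ** C ** B) = trace (B ** A ** C)"
    by (metis trace_mul_sym matrix_mul_assoc)
  then show ?thesis
    by (simp add: commutator_def mult_diff_left mult_diff_right trace_sub matrix_mul_assoc)
qed

lemma commutator_swap: "commutator A B = - commutator B A"
  by (simp add: commutator_def)

lemma Omega_orbit_commutator:
  assumes "\<xi> \<in> sp_alg" and "\<zeta> \<in> sp_alg"
  shows "Omega_orbit \<eta> (commutator \<xi> \<eta>) (commutator \<zeta> \<eta>) = 1/2 * trace (\<eta> ** commutator \<xi> \<zeta>)"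
proof -
  have left: "trace (\<eta> ** commutator a b) = trace (\<eta> ** commutator a' b)"
    if "commutator a \<eta> = commutator a' \<eta>" for a a' b :: "'a pmat"
    by (simp add: trace_commutator that)
  have right: "trace (\<eta> ** commutator a b) = trace (\<eta> ** commutator a b')"
    if "commutator b \<eta> = commutator b' \<eta>" for a b b' :: "'a pmat"
    using left[OF that, of a]
    by (simp add: commutator_swap[of a] neg_mult_right trace_neg)
  show ?thesis
    unfolding Omega_orbit_def
    by (rule the_equality) (use assms left right in \<open>blast, metis\<close>)
qed

end

theory Submission
  imports Defs
begin

text \<open>
  Both Hamiltonians are pullbacks of one function \<open>K(z, S) = H z + \<hbar>/4 Tr (S D\<^sup>2H)\<close>, linear in
  \<open>S\<close>, along \<open>S = E E\<^sup>T\<close> and \<open>S = \<zeta> J\<close>; these agree for \<open>\<zeta> = j_Sp E\<close>. The derivative of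
  \<open>K\<close> in \<open>z\<close> gives the first components, and the derivative in \<open>S\<close>, by symmetry of the Hessian,
  gives \<open>\<xi> E\<close> and \<open>[\<xi>, \<zeta>]\<close> with the same \<open>\<xi> = J D\<^sup>2H\<close> in \<open>sp\<close>. Since \<open>j_Sp\<close> turns left
  multiplication into conjugation, its tangent map sends the one to the other.
\<close>

section \<open>Matrix calculus\<close>

text \<open>Tangent vectors are velocities of curves inside the set, so every tangency claim needs
  an explicit curve, and every restriction on velocities comes from differentiating an identity that
  holds along the curve. The orbit is the delicate case: its curves are images of curves in
  \<open>Sp\<close> under \<open>j_Sp\<close>, and conversely the identities \<eta>\<eta> = -1 and
  \<eta> in sp already force a velocity to have the form [\<xi>,\<eta>]. The constants fit for
  different reasons. On \<open>GL\<close> the derivative of E E^T has two terms of equal trace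
  against a symmetric Hessian, which doubles hbar/4 to the hbar/2 of the form; on the orbit the
  derivative of \<zeta> J is a single term, and hbar/4 is hbar/2 times the 1/2 in the orbit form.
  Uniqueness of the vectors in the matrix directions reduces in both cases, after a suitable test
  vector, to the fact that Tr(A^T A) = 0 forces A = 0.\<close>

lemma bounded_bilinear_matrix_mult:
  "bounded_bilinear ((**) :: real^'n::finite^'m::finite \<Rightarrow> real^'p::finite^'n \<Rightarrow> real^'p^'m)"
proof -
  have "bilinear ((**) :: real^'n^'m \<Rightarrow> real^'p^'n \<Rightarrow> real^'p^'m)"
    unfolding bilinear_def linear_iff
    by (simp add: matrix_add_ldistrib matrix_scalar_ac scalar_matrix_assoc)
      (simp add: vec_eq_iff matrix_matrix_mult_def distrib_right sum.distrib)
  then show ?thesis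
    by (simp add: bilinear_conv_bounded_bilinear)
qed

lemma bounded_linear_transpose:
  "bounded_linear (transpose :: real^'n::finite^'m::finite \<Rightarrow> real^'m^'n)"
  unfolding linear_conv_bounded_linear[symmetric] linear_iff by (auto simp: transpose_def vec_eq_iff)

lemma bounded_linear_trace: "bounded_linear (trace :: real^'n::finite^'n \<Rightarrow> real)"
  unfolding linear_conv_bounded_linear[symmetric] linear_iff
  by (auto simp: trace_def sum.distrib sum_distrib_left)

lemmas has_derivative_matrix_mult [derivative_intros] =
  bounded_bilinear.FDERIV[OF bounded_bilinear_matrix_mult]
lemmas has_derivative_transpose [derivative_intros] =
  bounded_linear.has_derivative[OF bounded_linear_transpose]
lemmas has_derivative_trace [derivative_intros] =
  bounded_linear.has_derivative[OF bounded_linear_trace]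
lemmas has_vector_derivative_matrix_mult [derivative_intros] =
  bounded_bilinear.has_vector_derivative[OF bounded_bilinear_matrix_mult]
lemmas has_vector_derivative_transpose [derivative_intros] =
  bounded_linear.has_vector_derivative[OF bounded_linear_transpose]

lemma trace_transpose: "trace (transpose A) = trace (A :: real^'n::finite^'n)"
  by (simp add: trace_def transpose_def)

text \<open>The trace is the sum of the squares of all entries. Nondegeneracy of both trace forms
  rests on this.\<close>

lemma trace_transpose_mult_self_eq_0_iff:
  "trace (transpose A ** A) = 0 \<longleftrightarrow> A = (0 :: real^'n::finite^'n)"
proof -
  have "trace (transpose A ** A) = (\<Sum>i\<in>UNIV. \<Sum>k\<in>UNIV. A $ k $ i * A $ k $ i)"
    by (simp add: trace_def transpose_def matrix_matrix_mult_def)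
  then show ?thesis
    by (auto simp: sum_nonneg_eq_0_iff sum_nonneg vec_eq_iff)
qed

lemma transpose_diff: "transpose (A - B) = transpose A - transpose (B :: real^'n::finite^'m::finite)"
  by (simp add: transpose_def vec_eq_iff)

lemma transpose_add: "transpose (A + B) = transpose A + transpose (B :: real^'n::finite^'m::finite)"
  by (simp add: transpose_def vec_eq_iff)

lemma transpose_neg: "transpose (- A) = - transpose (A :: real^'n::finite^'m::finite)"
  by (simp add: transpose_def vec_eq_iff)

lemma mult_add_left: "(A + B) ** C = A ** C + B ** (C :: real^'m::finite^'m)"
  by (simp add: vec_eq_iff matrix_matrix_mult_def sum.distrib distrib_right)

lemma matrix_inv_eqI:
  fixes A B :: "real^'n::finite^'n"
  assumes "A ** B = mat 1"
  shows "matrix_inv A = B"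
proof -
  have BA: "B ** A = mat 1"
    using assms by (simp add: matrix_left_right_inverse)
  have "A ** matrix_inv A = mat 1 \<and> matrix_inv A ** A = mat 1"
    unfolding matrix_inv_def by (rule someI[of _ B]) (simp add: assms BA)
  then have "B ** A ** matrix_inv A = B"
    by (simp add: matrix_mul_assoc[symmetric])
  then show ?thesis
    by (simp add: BA)
qed

lemma matrix_inv_inverses:
  fixes A :: "real^'n::finite^'n"
  assumes "invertible A"
  shows "A ** matrix_inv A = mat 1" and "matrix_inv A ** A = mat 1"
proof -
  obtain B where B: "A ** B = mat 1" "B ** A = mat 1"
    using assms by (auto simp: invertible_def)
  from matrix_inv_eqI[OF B(1)] B show "A ** matrix_inv A = mat 1" and "matrix_inv A ** A = mat 1"
    by simp_all
qed

lemma matrix_inv_matrix_inv: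
  fixes A :: "real^'n::finite^'n"
  assumes "invertible A"
  shows "matrix_inv (matrix_inv A) = A"
  by (rule matrix_inv_eqI) (rule matrix_inv_inverses[OF assms])

text \<open>The identity \<open>R = 1 + t A R\<close> for \<open>R = (1 - t A)\<^sup>-\<^sup>1\<close> bounds \<open>R\<close> near \<open>t = 0\<close>, then
  gives its continuity and its derivative there.\<close>

lemma resolvent_curve:
  fixes A :: "real^'n::finite^'n"
  defines "R \<equiv> \<lambda>t. matrix_inv (mat 1 - t *\<^sub>R A)"
  shows "R 0 = mat 1"
    and "\<forall>\<^sub>F t in nhds 0. (mat 1 - t *\<^sub>R A) ** R t = mat 1"
    and "(R has_vector_derivative A) (at 0)"
proof -
  interpret mult: bounded_bilinear "(**) :: real^'n^'n \<Rightarrow> real^'n^'n \<Rightarrow> real^'n^'n"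
    by (rule bounded_bilinear_matrix_mult)
  show R0: "R 0 = mat 1"
    unfolding R_def by (rule matrix_inv_eqI) simp
  obtain K where K: "K > 0" "norm (B ** C) \<le> norm B * norm C * K" for B C :: "real^'n^'n"
    using mult.pos_bounded by blast
  obtain L where L: "L > 0" "norm (A *v x) \<le> norm x * L" for x
    using bounded_linear.pos_bounded[OF matrix_vector_mul_bounded_linear[of A]] by blast
  \<comment> \<open>The summand 1 keeps \<open>c\<close> positive when A = 0, so that 1 / (2c) makes
    sense.\<close>
  define c where "c = (norm A + 1) * K"
  have "c > 0"
    using K by (simp add: c_def add_nonneg_pos)
  \<comment> \<open>The first bound makes 1 - tA injective, the second makes the error term in R = 1
    + t A R at most half of the norm of R.\<close>
  define d where "d = min (1 / (2 * L)) (1 / (2 * c))"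
  have "d > 0"
    using L \<open>c > 0\<close> by (simp add: d_def)
  have inv: "(mat 1 - t *\<^sub>R A) ** R t = mat 1" if t: "\<bar>t\<bar> < d" for t
  proof -
    have "x = 0" if "(mat 1 - t *\<^sub>R A) *v x = 0" for x
    proof (rule ccontr)
      assume "x \<noteq> 0"
      have "x = t *\<^sub>R (A *v x)"
        using that by (simp add: matrix_vector_mult_diff_rdistrib scaleR_matrix_vector_assoc)
      then have "norm x = \<bar>t\<bar> * norm (A *v x)"
        by (metis norm_scaleR)
      also have "\<dots> \<le> \<bar>t\<bar> * (norm x * L)"
        by (intro mult_left_mono L) auto
      also have "\<dots> = (\<bar>t\<bar> * L) * norm x" by simp
      also have "\<dots> \<le> (1 / 2) * norm x"
        using t L by (intro mult_right_mono) (auto simp: d_def field_simps)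
      finally show False
        using \<open>x \<noteq> 0\<close> by simp
    qed
    then have "invertible (mat 1 - t *\<^sub>R A)"
      by (simp add: invertible_left_inverse matrix_left_invertible_ker)
    then show ?thesis
      unfolding R_def by (rule matrix_inv_inverses)
  qed
  have ev: "\<forall>\<^sub>F t in nhds 0. \<bar>t\<bar> < d"
    unfolding eventually_nhds_metric using \<open>d > 0\<close> by (auto simp: dist_norm)
  show "\<forall>\<^sub>F t in nhds 0. (mat 1 - t *\<^sub>R A) ** R t = mat 1"
    using ev by eventually_elim (rule inv)
  have ev0: "\<forall>\<^sub>F t in at 0. \<bar>t\<bar> < d"
    using ev by (simp add: eventually_at_filter eventually_mono)
  have R_eq: "R t = mat 1 + t *\<^sub>R (A ** R t)" if "\<bar>t\<bar> < d" for t
    using inv[OF that] by (simp add: mult.diff_left mult.scaleR_left diff_eq_eq)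
  \<comment> \<open>The error term, at most half of the norm of \<open>R t\<close>, is absorbed into
    the left-hand side; this gives the factor 2.\<close>
  have R_bound: "norm (R t) \<le> 2 * norm (mat 1 :: real^'n^'n)" if t: "\<bar>t\<bar> < d" for t
  proof -
    have "norm (R t) \<le> norm (mat 1 :: real^'n^'n) + \<bar>t\<bar> * norm (A ** R t)"
      by (metis R_eq[OF t] norm_triangle_ineq norm_scaleR)
    also have "\<bar>t\<bar> * norm (A ** R t) \<le> \<bar>t\<bar> * (norm A * norm (R t) * K)"
      by (intro mult_left_mono K) auto
    also have "\<dots> = (\<bar>t\<bar> * (norm A * K)) * norm (R t)" by simp
    also have "\<dots> \<le> (1 / 2) * norm (R t)"
    proof (intro mult_right_mono)
      have "\<bar>t\<bar> * (norm A * K) \<le> \<bar>t\<bar> * c"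
        unfolding c_def using K by (intro mult_left_mono mult_right_mono) auto
      also have "\<dots> \<le> 1 / (2 * c) * c"
        using t \<open>c > 0\<close> by (intro mult_right_mono) (auto simp: d_def)
      also have "\<dots> = 1 / 2"
        using \<open>c > 0\<close> by simp
      finally show "\<bar>t\<bar> * (norm A * K) \<le> 1 / 2" .
    qed auto
    finally show ?thesis by simp
  qed
  have "((\<lambda>t. t *\<^sub>R (A ** R t)) \<longlongrightarrow> 0) (at 0)"
  proof (rule tendsto_0_le[where K = "norm A * (2 * norm (mat 1 :: real^'n^'n)) * K"])
    show "((\<lambda>t::real. t) \<longlongrightarrow> 0) (at 0)" by (rule tendsto_ident_at)
    show "\<forall>\<^sub>F t in at 0. norm (t *\<^sub>R (A ** R t))
      \<le> norm t * (norm A * (2 * norm (mat 1 :: real^'n^'n)) * K)"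
      using ev0
    proof eventually_elim
      case (elim t)
      have "norm (A ** R t) \<le> norm A * norm (R t) * K" by (rule K)
      also have "\<dots> \<le> norm A * (2 * norm (mat 1 :: real^'n^'n)) * K"
        using R_bound[OF elim] K by (intro mult_right_mono mult_left_mono) auto
      finally show ?case by (auto intro: mult_left_mono)
    qed
  qed
  then have "((\<lambda>t. mat 1 + t *\<^sub>R (A ** R t)) \<longlongrightarrow> mat 1) (at 0)"
    using tendsto_add[OF tendsto_const] by fastforce
  then have "(R \<longlongrightarrow> mat 1) (at 0)"
    by (rule Lim_transform_eventually) (use ev0 R_eq in \<open>auto elim: eventually_mono\<close>)
  then have "((\<lambda>t. A ** R t) \<longlongrightarrow> A) (at 0)"
    using mult.tendsto[OF tendsto_const[of A]] by fastforce
  then have "((\<lambda>t. norm (A ** R t - A)) \<longlongrightarrow> 0) (at 0)"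
    by (simp add: tendsto_norm_zero LIM_zero)
  moreover have "\<forall>\<^sub>F t in at 0. norm (A ** R t - A) = norm (R (0 + t) - R 0 - t *\<^sub>R A) / norm t"
    using ev0 eventually_neq_at_within[of 0 0 UNIV]
  proof eventually_elim
    case (elim t)
    have "R (0 + t) - R 0 - t *\<^sub>R A = t *\<^sub>R (A ** R t - A)"
      using R_eq[OF elim(1)] by (simp add: R0 scaleR_diff_right) (metis add_diff_cancel_left')
    then show ?case
      using elim(2) by simp
  qed
  ultimately have "((\<lambda>t. norm (R (0 + t) - R 0 - t *\<^sub>R A) / norm t) \<longlongrightarrow> 0) (at 0)"
    by (rule Lim_transform_eventually)
  then show "(R has_vector_derivative A) (at 0)"
    unfolding has_vector_derivative_def has_derivative_at
    by (simp add: bounded_linear_scaleR_left)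
qed

section \<open>Symmetry of the Hessian and the corrected Hamiltonian\<close>

lemma smooth_C_k:
  assumes "smooth f"
  shows "C_k k f"
  using assms by (simp add: smooth_def)

lemma smooth_differentiable:
  assumes "smooth f"
  shows "f differentiable (at x)"
  using smooth_C_k[OF assms, of 1] by simp

lemma smooth_partial:
  assumes "smooth f"
  shows "smooth (partial i f)"
  unfolding smooth_def
proof
  fix k
  show "C_k k (partial i f)"
    using smooth_C_k[OF assms, of "Suc k"] by (simp add: partial_def[abs_def])
qed

lemma has_real_derivative_along_line:
  fixes f :: "'a::real_normed_vector \<Rightarrow> real"
  assumes "f differentiable (at (a + s *\<^sub>R v))"
  shows "((\<lambda>s. f (a + s *\<^sub>R v)) has_real_derivative frechet_derivative f (at (a + s *\<^sub>R v)) v) (at s)"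
proof -
  let ?D = "frechet_derivative f (at (a + s *\<^sub>R v))"
  have D: "(f has_derivative ?D) (at (a + s *\<^sub>R v))"
    using assms by (simp add: frechet_derivative_works)
  have "((\<lambda>s. f (a + s *\<^sub>R v)) has_derivative (\<lambda>h. ?D (h *\<^sub>R v))) (at s)"
    by (rule has_derivative_compose[of "\<lambda>s. a + s *\<^sub>R v" "\<lambda>h. h *\<^sub>R v" s UNIV f ?D, OF _ D])
      (auto intro!: derivative_eq_intros)
  moreover have "(\<lambda>h. ?D (h *\<^sub>R v)) = (*) (?D v)"
    using linear_scale[OF has_derivative_linear[OF D]] by (auto simp: mult.commute)
  ultimately show ?thesis
    by (simp add: has_field_derivative_def)
qed

text \<open>The second difference quotient converges to one iterated derivative by two applications
  of the mean value theorem, and it is symmetric in the two directions.\<close>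

lemma second_difference_quotient_tendsto:
  fixes f :: "'a::real_normed_vector \<Rightarrow> real"
  assumes f: "C_k 2 f"
  shows "((\<lambda>t. (f (z + t *\<^sub>R u + t *\<^sub>R v) - f (z + t *\<^sub>R u) - f (z + t *\<^sub>R v) + f z) / t\<^sup>2)
    \<longlongrightarrow> frechet_derivative (\<lambda>x. frechet_derivative f (at x) u) (at z) v) (at_right 0)"
proof -
  define F where "F = (\<lambda>x. frechet_derivative f (at x) u)"
  define G where "G = (\<lambda>x. frechet_derivative F (at x) v)"
  define Q where "Q = (\<lambda>t. (f (z + t *\<^sub>R u + t *\<^sub>R v) - f (z + t *\<^sub>R u) - f (z + t *\<^sub>R v) + f z) / t\<^sup>2)"
  have f_diff: "f differentiable (at x)" and F_diff: "F differentiable (at x)"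
    and G_cont: "isCont G z" for x
    using f by (auto simp: F_def G_def numeral_2_eq_2 continuous_on_eq_continuous_at)
  have mean: "\<exists>s r. \<bar>s\<bar> < t \<and> \<bar>r\<bar> < t \<and> Q t = G (z + s *\<^sub>R u + r *\<^sub>R v)" if "t > 0" for t
  proof -
    \<comment> \<open>The increment in direction v is followed along u, so the mean value theorem
      produces an increment of \<open>F\<close>. A second application, along v, turns that into a
      value of \<open>G\<close>.\<close>
    let ?g = "\<lambda>s. f (z + t *\<^sub>R v + s *\<^sub>R u) - f (z + s *\<^sub>R u)"
    have "(?g has_real_derivative F (z + t *\<^sub>R v + s *\<^sub>R u) - F (z + s *\<^sub>R u)) (at s)" for s
      unfolding F_def by (intro DERIV_diff has_real_derivative_along_line f_diff)
    from MVT2[OF \<open>t > 0\<close> this] obtain s where s: "0 < s" "s < t"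
      "?g t - ?g 0 = (t - 0) * (F (z + t *\<^sub>R v + s *\<^sub>R u) - F (z + s *\<^sub>R u))"
      by blast
    have "((\<lambda>r. F (z + s *\<^sub>R u + r *\<^sub>R v)) has_real_derivative G (z + s *\<^sub>R u + r *\<^sub>R v)) (at r)" for r
      unfolding G_def by (intro has_real_derivative_along_line F_diff)
    from MVT2[OF \<open>t > 0\<close> this] obtain r where r: "0 < r" "r < t"
      "F (z + s *\<^sub>R u + t *\<^sub>R v) - F (z + s *\<^sub>R u + 0 *\<^sub>R v) = (t - 0) * G (z + s *\<^sub>R u + r *\<^sub>R v)"
      by blast
    have "f (z + t *\<^sub>R u + t *\<^sub>R v) - f (z + t *\<^sub>R u) - f (z + t *\<^sub>R v) + f z = ?g t - ?g 0"
      by (simp add: add_ac)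
    also have "\<dots> = t\<^sup>2 * G (z + s *\<^sub>R u + r *\<^sub>R v)"
      using s(3) r(3) by (simp add: add_ac power2_eq_square)
    finally have "Q t = G (z + s *\<^sub>R u + r *\<^sub>R v)"
      using \<open>t > 0\<close> by (simp add: Q_def)
    then show ?thesis
      using s r by (intro exI[of _ s] exI[of _ r]) auto
  qed
  have "(Q \<longlongrightarrow> G z) (at_right 0)"
  proof (rule tendstoI)
    fix e :: real
    assume "e > 0"
    with G_cont obtain d where d: "d > 0" "\<And>x. dist x z < d \<Longrightarrow> dist (G x) (G z) < e"
      unfolding continuous_at_eps_delta by blast
    \<comment> \<open>The intermediate point lies within t * c of z. The summand 1 keeps
      \<open>c\<close> positive when u = v = 0.\<close>
    define c where "c = norm u + norm v + 1"
    have "c > 0"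
      by (simp add: c_def add_nonneg_pos)
    have "dist (Q t) (G z) < e" if t: "0 < t" "t < d / c" for t
    proof -
      obtain s r where sr: "\<bar>s\<bar> < t" "\<bar>r\<bar> < t" "Q t = G (z + s *\<^sub>R u + r *\<^sub>R v)"
        using mean t by blast
      have "norm (s *\<^sub>R u + r *\<^sub>R v) \<le> \<bar>s\<bar> * norm u + \<bar>r\<bar> * norm v"
        by (metis norm_triangle_ineq norm_scaleR)
      also have "\<dots> \<le> t * norm u + t * norm v"
        using sr by (intro add_mono mult_right_mono) auto
      also have "\<dots> \<le> t * c"
        using t by (simp add: c_def algebra_simps)
      also have "\<dots> < d"
        using t \<open>c > 0\<close> by (simp add: field_simps)
      finally show ?thesis
        using sr d by (simp add: dist_norm add.assoc)
    qed
    then show "\<forall>\<^sub>F t in at_right 0. dist (Q t) (G z) < e"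
      unfolding eventually_at_right_field using \<open>d > 0\<close> \<open>c > 0\<close> by (intro exI[of _ "d / c"]) auto
  qed
  then show ?thesis
    by (simp add: Q_def G_def F_def)
qed

lemma frechet_derivative_frechet_derivative_commute:
  fixes f :: "'a::real_normed_vector \<Rightarrow> real"
  assumes "C_k 2 f"
  shows "frechet_derivative (\<lambda>x. frechet_derivative f (at x) u) (at z) v
    = frechet_derivative (\<lambda>x. frechet_derivative f (at x) v) (at z) u"
proof (rule tendsto_unique[OF _ second_difference_quotient_tendsto[OF assms]])
  show "((\<lambda>t. (f (z + t *\<^sub>R u + t *\<^sub>R v) - f (z + t *\<^sub>R u) - f (z + t *\<^sub>R v) + f z) / t\<^sup>2)
    \<longlongrightarrow> frechet_derivative (\<lambda>x. frechet_derivative f (at x) v) (at z) u) (at_right 0)"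
    using second_difference_quotient_tendsto[OF assms, of z v u] by (simp add: algebra_simps)
qed simp

lemma transpose_hessian:
  assumes "smooth H"
  shows "transpose (hessian H z) = hessian H z"
  using frechet_derivative_frechet_derivative_commute[OF smooth_C_k[OF assms, of 2]]
  by (simp add: transpose_def hessian_def partial_def[abs_def] vec_eq_iff)

text \<open>Testing against the standard basis isolates single entries, and each of these is an
  iterated partial derivative, hence smooth.\<close>

lemma hessian_differentiable:
  assumes "smooth H"
  shows "hessian H differentiable (at z)"
proof -
  have "(\<lambda>z. hessian H z \<bullet> b) differentiable (at z)" if b: "b \<in> Basis" for b
  proof -
    obtain i j where "b = axis i (axis j 1)"
      using b by (auto simp: Basis_vec_def)
    then have "(\<lambda>z. hessian H z \<bullet> b) = partial i (partial j H)"
      by (simp add: inner_axis hessian_def fun_eq_iff)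
    then show ?thesis
      using smooth_differentiable[OF smooth_partial[OF smooth_partial[OF assms]]] by simp
  qed
  then show ?thesis
    by (rule differentiable_componentwise_within[THEN iffD2, OF ballI])
qed

section \<open>Laplacians of constant metrics and the derivative of the corrected
  Hamiltonian\<close>

lemma partial_sum_mult:
  fixes f :: "'i \<Rightarrow> real^'m::finite \<Rightarrow> real"
  assumes "\<And>j. j \<in> A \<Longrightarrow> f j differentiable (at z)"
  shows "partial i (\<lambda>y. \<Sum>j\<in>A. c j * f j y) z = (\<Sum>j\<in>A. c j * partial i (f j) z)"
proof -
  have "((\<lambda>y. \<Sum>j\<in>A. c j * f j y) has_derivative
      (\<lambda>h. \<Sum>j\<in>A. c j * frechet_derivative (f j) (at z) h)) (at z)"
    by (intro has_derivative_sum has_derivative_mult_right)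
      (use assms in \<open>simp add: frechet_derivative_works\<close>)
  from frechet_derivative_at[OF this] show ?thesis
    by (simp add: partial_def fun_eq_iff)
qed

text \<open>The inverse Gram matrix is constant and leaves the divergence, which pairs its entries
  with second partials of the same index order. This is a trace against the transposed Hessian, and
  symmetry removes the transpose.\<close>

lemma laplacian_eq_trace:
  assumes "smooth H"
  shows "laplacian G H z = trace (matrix_inv G ** hessian H z)"
proof -
  have "partial i (\<lambda>y. gradient G H y $ i) z
      = (\<Sum>j\<in>UNIV. matrix_inv G $ i $ j * partial i (partial j H) z)" for i
    unfolding gradient_def matrix_vector_mult_def
    by (simp add: partial_sum_mult smooth_differentiable smooth_partial assms)
  then have "laplacian G H z = trace (matrix_inv G ** transpose (hessian H z))"
    by (simp add: laplacian_def trace_def matrix_matrix_mult_def hessian_def transpose_def)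
  then show ?thesis
    by (simp add: transpose_hessian[OF assms])
qed

text \<open>The common function K of the overview. With \<open>S\<close> as a separate argument,
  \<open>corrected hbar H S\<close> is the function of z whose Hamiltonian field forms the first
  component, with the matrix held fixed.\<close>

definition corrected :: "real \<Rightarrow> (real^'m::finite \<Rightarrow> real) \<Rightarrow> real^'m^'m \<Rightarrow> real^'m \<Rightarrow> real" where
  "corrected hbar H S z = H z + hbar / 4 * trace (S ** hessian H z)"

text \<open>The z-part is left as the derivative at fixed \<open>S\<close>: in this form it is the
  value that \<open>omega\<close> assigns to the first component of the field.\<close>

lemma has_derivative_corrected:
  assumes "smooth H"
  shows "((\<lambda>(z, S). corrected hbar H S z) has_derivative
    (\<lambda>(w, V). frechet_derivative (corrected hbar H S) (at z) w + hbar / 4 * trace (V ** hessian H z)))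
    (at (z, S))"
proof -
  let ?DH = "frechet_derivative H (at z)" and ?DD = "frechet_derivative (hessian H) (at z)"
  have H: "(H has_derivative ?DH) (at z)" and D: "(hessian H has_derivative ?DD) (at z)"
    using smooth_differentiable[OF assms] hessian_differentiable[OF assms]
    by (simp_all add: frechet_derivative_works)
  have "(corrected hbar H S has_derivative (\<lambda>w. ?DH w + hbar / 4 * trace (S ** ?DD w))) (at z)"
    unfolding corrected_def[abs_def] by (auto intro!: derivative_eq_intros H D)
  note fixed = frechet_derivative_at[OF this, symmetric]
  have [derivative_intros]: "((\<lambda>p. H (fst p)) has_derivative (\<lambda>p. ?DH (fst p))) (at (z, S))"
    "((\<lambda>p. hessian H (fst p)) has_derivative (\<lambda>p. ?DD (fst p))) (at (z, S))"
    using H D by (auto intro!: has_derivative_compose[of fst] derivative_intros)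
  show ?thesis
    unfolding fixed corrected_def case_prod_beta
    by (auto intro!: derivative_eq_intros simp: trace_add algebra_simps)
qed

lemma corrected_differentiable:
  assumes "smooth H"
  shows "corrected hbar H S differentiable (at z)"
proof -
  let ?DH = "frechet_derivative H (at z)" and ?DD = "frechet_derivative (hessian H) (at z)"
  have "(H has_derivative ?DH) (at z)" and "(hessian H has_derivative ?DD) (at z)"
    using smooth_differentiable[OF assms] hessian_differentiable[OF assms]
    by (simp_all add: frechet_derivative_works)
  then have "(corrected hbar H S has_derivative (\<lambda>w. ?DH w + hbar / 4 * trace (S ** ?DD w))) (at z)"
    unfolding corrected_def[abs_def] by (auto intro!: derivative_eq_intros)
  then show ?thesis
    by (rule differentiableI)
qed

section \<open>Tangent spaces of the matrix groups and of the orbit\<close>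

lemma transpose_JJ: "transpose JJ = - (JJ :: 'n::finite pmat)"
proof -
  have "transpose JJ $ i $ j = (- (JJ :: 'n pmat)) $ i $ j" for i j
    by (cases i; cases j) (auto simp: JJ_def transpose_def)
  then show ?thesis
    by (simp add: vec_eq_iff)
qed

lemma mult_JJ_JJ: "A ** JJ ** JJ = - (A :: 'n::finite pmat)"
  by (simp add: matrix_mul_assoc[symmetric] JJ_square neg_mult_right)

text \<open>Right multiplication by J is injective because J J = -1. Solving for the transpose makes
  membership usable as a rewrite rule.\<close>

lemma mem_sp_alg_iff: "\<xi> \<in> sp_alg \<longleftrightarrow> transpose \<xi> = JJ ** \<xi> ** (JJ :: 'n::finite pmat)"
proof -
  have "transpose \<xi> ** JJ + JJ ** \<xi> = 0 \<longleftrightarrow> (transpose \<xi> ** JJ) ** JJ = (- (JJ ** \<xi>)) ** JJ"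
    by (metis add_eq_0_iff mult_JJ_JJ minus_equation_iff)
  then show ?thesis
    by (simp add: sp_alg_def mult_JJ_JJ neg_mult_left)
qed

lemma commutator_mem_sp_alg:
  assumes "\<xi> \<in> sp_alg" and "\<eta> \<in> sp_alg"
  shows "commutator \<xi> \<eta> \<in> sp_alg"
  using assms
  by (simp add: mem_sp_alg_iff commutator_def transpose_diff matrix_transpose_mul matrix_mul_assoc
      mult_JJ_JJ neg_mult_left mult_diff_left mult_diff_right)

text \<open>The map taking X to J X J is an involution. Closure under transposition supplies the
  test vector that shows the orbit form to be nondegenerate.\<close>

lemma transpose_mem_sp_alg:
  assumes "\<xi> \<in> sp_alg"
  shows "transpose \<xi> \<in> sp_alg"
proof -
  have "JJ ** (JJ ** \<xi> ** JJ) ** JJ = \<xi>"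
    by (simp add: matrix_mul_assoc mult_JJ_JJ JJ_square neg_mult_left)
  then show ?thesis
    using assms by (metis mem_sp_alg_iff transpose_transpose)
qed

text \<open>J D is the linear Hamiltonian field of the quadratic form with matrix D. Through this
  lemma the symmetry of the Hessian yields \<xi> in sp.\<close>

lemma JJ_symmetric_mem_sp_alg:
  assumes "transpose D = D"
  shows "JJ ** D \<in> sp_alg"
  using assms
  by (simp add: mem_sp_alg_iff matrix_transpose_mul transpose_JJ matrix_mul_assoc JJ_square
      neg_mult_left neg_mult_right)

lemma Sp_mult:
  assumes "E \<in> Sp" and "F \<in> Sp"
  shows "E ** F \<in> Sp"
proof -
  have "transpose (E ** F) ** JJ ** (E ** F) = transpose F ** (transpose E ** JJ ** E) ** F"
    by (simp add: matrix_transpose_mul matrix_mul_assoc)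
  then show ?thesis
    using assms by (simp add: Sp_def)
qed

lemma Sp_subset_GL: "Sp \<subseteq> GL"
  using Sp_inverse(1) by (auto simp: GL_def invertible_right_inverse)

text \<open>Orbit points are conjugates of -J, so they are complex structures. This equation shapes
  the tangent space and also inverts \<zeta> J.\<close>

lemma orbit_square:
  assumes "\<eta> \<in> orbit"
  shows "\<eta> ** \<eta> = - mat 1"
proof -
  obtain E where E: "E \<in> Sp" "\<eta> = j_Sp E"
    using assms j_Sp_image by blast
  have "\<eta> ** \<eta> = E ** (transpose E ** JJ ** E) ** transpose E ** JJ"
    by (simp add: E(2) j_Sp_def neg_mult_left neg_mult_right matrix_mul_assoc)
  also have "\<dots> = - (E ** (- (JJ ** transpose E ** JJ)))"
    using E(1) by (simp add: Sp_def neg_mult_right matrix_mul_assoc)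
  finally show ?thesis
    by (simp add: Sp_inverse(1)[OF E(1)])
qed

lemma orbit_subset_sp_alg: "orbit \<subseteq> sp_alg"
  by (auto simp: j_Sp_image[symmetric] j_Sp_def mem_sp_alg_iff transpose_neg matrix_transpose_mul
      transpose_JJ matrix_mul_assoc mult_JJ_JJ neg_mult_left neg_mult_right)

section \<open>Curves, tangent values and uniqueness of Hamiltonian vectors\<close>

lemma curve_at_linear:
  assumes "\<forall>\<^sub>F t in nhds 0. x + t *\<^sub>R v \<in> M"
  shows "curve_at M x v (\<lambda>t. x + t *\<^sub>R v)"
  unfolding curve_at_def using assms by (auto intro!: derivative_eq_intros)

text \<open>Curves in M are curves in the ambient space, so the ordinary chain rule settles the
  tangent value for every M.\<close>

lemma has_tangent_value_of_has_derivative: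
  assumes f: "(f has_derivative f') (at x)"
  shows "has_tangent_value M f x v (f' v)"
  unfolding has_tangent_value_def
proof (intro allI impI)
  fix \<gamma>
  assume "curve_at M x v \<gamma>"
  then have g: "\<gamma> 0 = x" "(\<gamma> has_derivative (\<lambda>t. t *\<^sub>R v)) (at 0)"
    by (auto simp: curve_at_def has_vector_derivative_def)
  have "((\<lambda>t. f (\<gamma> t)) has_derivative (\<lambda>t. f' (t *\<^sub>R v))) (at 0)"
    using has_derivative_compose[OF g(2), of f f'] f g(1) by simp
  then show "((f \<circ> \<gamma>) has_vector_derivative f' v) (at 0)"
    using linear_scale[OF has_derivative_linear[OF f]]
    by (simp add: has_vector_derivative_def comp_def)
qed

lemma has_tangent_value_unique:
  assumes "has_tangent_value M f x v w" and "has_tangent_value M f x v w'"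
    and "v \<in> tangent_space M x"
  shows "w = w'"
proof -
  obtain \<gamma> where "curve_at M x v \<gamma>"
    using assms(3) by (auto simp: tangent_space_def)
  with assms(1,2) show ?thesis
    unfolding has_tangent_value_def by (blast intro: vector_derivative_unique_at)
qed

lemma tangent_map_eqI:
  assumes "has_tangent_value M f x v w" and "v \<in> tangent_space M x"
  shows "tangent_map M f x v = w"
  unfolding tangent_map_def using assms by (blast intro: has_tangent_value_unique)

text \<open>Tangent values are unique, so any Hamiltonian vector pairs with all tangent vectors as
  \<open>X\<close> does. What remains is nondegeneracy relative to the candidate.\<close>

lemma hamiltonian_vf_eqI:
  assumes X: "is_hamiltonian_vector M \<Omega> f x X"
    and nondegenerate: "\<And>Y. \<lbrakk>Y \<in> tangent_space M x; \<And>w. w \<in> tangent_space M x \<Longrightarrow> \<Omega> x Y w = \<Omega> x X w\<rbrakk>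
      \<Longrightarrow> Y = X"
  shows "\<exists>!Y. is_hamiltonian_vector M \<Omega> f x Y" and "hamiltonian_vf M \<Omega> f x = X"
proof -
  have unique: "Y = X" if "is_hamiltonian_vector M \<Omega> f x Y" for Y
    using that X unfolding is_hamiltonian_vector_def
    by (intro nondegenerate) (auto intro: has_tangent_value_unique)
  then show "\<exists>!Y. is_hamiltonian_vector M \<Omega> f x Y"
    using X by blast
  show "hamiltonian_vf M \<Omega> f x = X"
    unfolding hamiltonian_vf_def using X unique by blast
qed

lemma tangent_space_UNIV: "tangent_space UNIV x = UNIV"
  by (auto simp: tangent_space_def intro!: exI curve_at_linear)

lemma tangent_space_Times_UNIV:
  fixes x :: "'a::real_normed_vector" and y :: "'b::real_normed_vector"
  shows "tangent_space (UNIV \<times> M) (x, y) = UNIV \<times> tangent_space M y"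
proof (intro set_eqI iffI)
  fix p :: "'a \<times> 'b"
  assume "p \<in> tangent_space (UNIV \<times> M) (x, y)"
  then obtain \<gamma> where "curve_at (UNIV \<times> M) (x, y) p \<gamma>"
    by (auto simp: tangent_space_def)
  then have "curve_at M y (snd p) (\<lambda>t. snd (\<gamma> t))"
    by (auto simp: curve_at_def mem_Times_iff
        intro: bounded_linear.has_vector_derivative[OF bounded_linear_snd])
  then show "p \<in> UNIV \<times> tangent_space M y"
    by (auto simp: tangent_space_def mem_Times_iff)
next
  fix p :: "'a \<times> 'b"
  assume "p \<in> UNIV \<times> tangent_space M y"
  then obtain v w \<gamma> where p: "p = (v, w)" "curve_at M y w \<gamma>"
    by (auto simp: tangent_space_def)
  have "((\<lambda>t. (x + t *\<^sub>R v, \<gamma> t)) has_vector_derivative (v, w)) (at 0)"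
    using p(2) by (auto simp: curve_at_def has_vector_derivative_def intro!: derivative_eq_intros)
  then have "curve_at (UNIV \<times> M) (x, y) p (\<lambda>t. (x + t *\<^sub>R v, \<gamma> t))"
    using p by (auto simp: curve_at_def)
  then show "p \<in> tangent_space (UNIV \<times> M) (x, y)"
    by (auto simp: tangent_space_def)
qed

lemma tangent_space_GL:
  fixes E :: "'n::finite pmat"
  assumes "E \<in> GL"
  shows "tangent_space GL E = UNIV"
proof -
  have "curve_at GL E V (\<lambda>t. E + t *\<^sub>R V)" for V
  proof (rule curve_at_linear)
    \<comment> \<open>Factoring E + tV = E (1 + t E^-1 V) reduces the openness of \<open>GL\<close>
      to the resolvent; the sign of \<open>?A\<close> matches 1 - tA.\<close>
    let ?A = "- (matrix_inv E ** V)"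
    have E: "invertible E"
      using assms by (simp add: GL_def)
    have "E + t *\<^sub>R V = E ** (mat 1 - t *\<^sub>R ?A)" for t
      using matrix_inv_inverses(1)[OF E]
      by (simp add: matrix_add_ldistrib neg_mult_right matrix_mul_assoc
          bounded_bilinear.scaleR_right[OF bounded_bilinear_matrix_mult])
    then show "\<forall>\<^sub>F t in nhds 0. E + t *\<^sub>R V \<in> GL"
      using resolvent_curve(2)[of ?A]
      by (auto elim!: eventually_mono simp: GL_def invertible_right_inverse intro!: invertible_mult E)
        (metis E invertible_mult invertible_right_inverse)
  qed
  then show ?thesis
    by (auto simp: tangent_space_def)
qed

text \<open>The Cayley transform \<open>(1 + t \<xi>/2) (1 - t \<xi>/2)\<^sup>-\<^sup>1\<close> replaces \<open>exp (t \<xi>)\<close>.\<close>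

lemma mult_mem_tangent_space_Sp:
  fixes E :: "'n::finite pmat"
  assumes "\<xi> \<in> sp_alg" and "E \<in> Sp"
  shows "\<xi> ** E \<in> tangent_space Sp E"
proof -
  \<comment> \<open>Numerator and inverse denominator each contribute velocity \<open>A\<close>; the
    factor 1/2 makes the sum \<xi>.\<close>
  define A where "A = (1/2) *\<^sub>R \<xi>"
  define P where "P = (\<lambda>t. mat 1 - t *\<^sub>R A)"
  define Q where "Q = (\<lambda>t. mat 1 + t *\<^sub>R A)"
  define R where "R = (\<lambda>t. matrix_inv (P t))"
  note bl = bounded_bilinear_matrix_mult
  have R: "R 0 = mat 1" "\<forall>\<^sub>F t in nhds 0. P t ** R t = mat 1" "(R has_vector_derivative A) (at 0)"
    unfolding R_def P_def by (rule resolvent_curve)+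
  have "transpose A ** JJ = - (JJ ** A)"
    using assms(1)
    by (simp add: A_def mem_sp_alg_iff transpose_scalar bounded_bilinear.scaleR_left[OF bl]
        bounded_bilinear.scaleR_right[OF bl] mult_JJ_JJ)
  \<comment> \<open>Moving J across a transpose exchanges P and Q. As P and Q commute, Q R preserves
    J.\<close>
  then have PJ: "transpose (P t) ** JJ = JJ ** Q t" and QJ: "transpose (Q t) ** JJ = JJ ** P t" for t
    by (simp_all add: P_def Q_def transpose_diff transpose_add transpose_scalar mult_diff_left
        mult_diff_right mult_add_left matrix_add_ldistrib bounded_bilinear.scaleR_left[OF bl]
        bounded_bilinear.scaleR_right[OF bl])
  have PQ: "P t ** Q t = Q t ** P t" for t
    by (simp add: P_def Q_def mult_diff_left mult_diff_right mult_add_left matrix_add_ldistrib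
        bounded_bilinear.scaleR_left[OF bl] bounded_bilinear.scaleR_right[OF bl]
        scaleR_diff_right scaleR_add_right)
  have "Q t ** R t \<in> Sp" if PR: "P t ** R t = mat 1" for t
  proof -
    have "transpose (Q t ** R t) ** JJ ** (Q t ** R t)
        = transpose (R t) ** (transpose (Q t) ** JJ) ** Q t ** R t"
      by (simp add: matrix_transpose_mul matrix_mul_assoc)
    also have "\<dots> = transpose (R t) ** JJ ** (P t ** Q t) ** R t"
      by (simp add: QJ matrix_mul_assoc)
    also have "\<dots> = transpose (R t) ** (JJ ** Q t) ** (P t ** R t)"
      by (simp add: PQ matrix_mul_assoc)
    also have "\<dots> = transpose (R t) ** (transpose (P t) ** JJ)"
      by (simp add: PR PJ matrix_mul_assoc)
    also have "\<dots> = transpose (P t ** R t) ** JJ"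
      by (simp add: matrix_transpose_mul matrix_mul_assoc)
    finally show ?thesis
      by (simp add: PR Sp_def)
  qed
  then have "\<forall>\<^sub>F t in nhds 0. Q t ** R t ** E \<in> Sp"
    using R(2) by (auto elim!: eventually_mono intro: Sp_mult assms(2))
  moreover have "((\<lambda>t. Q t ** R t ** E) has_vector_derivative \<xi> ** E) (at 0)"
  proof -
    have Q: "(Q has_vector_derivative A) (at 0)"
      unfolding Q_def by (auto intro!: derivative_eq_intros)
    have "((\<lambda>t. Q t ** R t ** E) has_vector_derivative
        Q 0 ** R 0 ** 0 + (Q 0 ** A + A ** R 0) ** E) (at 0)"
      by (intro has_vector_derivative_matrix_mult has_vector_derivative_const Q R)
    moreover have "A + A = \<xi>"
      by (simp add: A_def scaleR_2[symmetric])
    ultimately show ?thesis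
      by (simp add: R(1)) (simp add: Q_def)
  qed
  ultimately have "curve_at Sp E (\<xi> ** E) (\<lambda>t. Q t ** R t ** E)"
    by (simp add: curve_at_def R(1)) (simp add: Q_def)
  then show ?thesis
    by (auto simp: tangent_space_def)
qed

lemma has_derivative_j_Sp:
  "(j_Sp has_derivative (\<lambda>V. - ((E ** transpose V + V ** transpose E) ** JJ))) (at E)"
  unfolding j_Sp_def[abs_def] by (auto intro!: derivative_eq_intros)

text \<open>Varying the left factor of E E^T J gives \<xi> E E^T J. Varying the right one gives E
  E^T \<xi>^T J, and \<xi>^T J = -J \<xi> turns it into the other half of the commutator.\<close>

lemma has_tangent_value_j_Sp:
  assumes "\<xi> \<in> sp_alg"
  shows "has_tangent_value M j_Sp E (\<xi> ** E) (commutator \<xi> (j_Sp E))"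
proof -
  have "transpose \<xi> ** JJ = - (JJ ** \<xi>)"
    using assms by (simp add: mem_sp_alg_iff mult_JJ_JJ)
  then have "E ** transpose E ** (transpose \<xi> ** JJ) = - (E ** transpose E ** JJ ** \<xi>)"
    by (simp add: neg_mult_right matrix_mul_assoc)
  then have "- ((E ** transpose (\<xi> ** E) + \<xi> ** E ** transpose E) ** JJ) = commutator \<xi> (j_Sp E)"
    by (simp add: commutator_def j_Sp_def mult_add_left matrix_transpose_mul matrix_mul_assoc
        neg_mult_left neg_mult_right)
  then show ?thesis
    using has_tangent_value_of_has_derivative[OF has_derivative_j_Sp[of E], of M "\<xi> ** E"] by simp
qed

text \<open>Turns an identity valid along a curve near its base point into a linear condition on the
  velocity. The neighbourhood includes the base point, whose value enters the derivative.\<close>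

lemma has_vector_derivative_eventually_const:
  assumes "(f has_vector_derivative d) (at x)" and "\<forall>\<^sub>F t in nhds x. f t = c"
  shows "d = 0"
proof -
  have "((\<lambda>_. c) has_vector_derivative d) (at x)"
    using has_vector_derivative_cong_ev[of UNIV f "\<lambda>_. c" x d] assms
      eventually_nhds_x_imp_x[OF assms(2)] by simp
  then show ?thesis
    using vector_derivative_unique_at has_vector_derivative_const by blast
qed

text \<open>Differentiating \<open>\<eta>\<^sup>2 = -1\<close> along a curve gives \<open>\<eta>' \<eta> = - \<eta> \<eta>'\<close>, hence
  \<open>\<eta>' = [\<xi>, \<eta>]\<close> for \<open>\<xi> = - \<eta>' \<eta> / 2\<close>.\<close>

lemma tangent_space_orbit:
  fixes \<eta> :: "'n::finite pmat"
  assumes "\<eta> \<in> orbit"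
  shows "tangent_space orbit \<eta> = {commutator \<xi> \<eta> | \<xi>. \<xi> \<in> sp_alg}"
proof (intro set_eqI iffI)
  fix V
  assume "V \<in> {commutator \<xi> \<eta> | \<xi>. \<xi> \<in> sp_alg}"
  then obtain \<xi> where \<xi>: "\<xi> \<in> sp_alg" "V = commutator \<xi> \<eta>"
    by blast
  obtain E where E: "E \<in> Sp" "\<eta> = j_Sp E"
    using assms j_Sp_image by blast
  obtain \<gamma> where \<gamma>: "curve_at Sp E (\<xi> ** E) \<gamma>"
    using mult_mem_tangent_space_Sp[OF \<xi>(1) E(1)] by (auto simp: tangent_space_def)
  then have "curve_at orbit \<eta> V (j_Sp \<circ> \<gamma>)"
    using has_tangent_value_j_Sp[OF \<xi>(1), of Sp E] \<xi> E j_Sp_image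
    by (auto simp: curve_at_def has_tangent_value_def elim!: eventually_mono)
  then show "V \<in> tangent_space orbit \<eta>"
    by (auto simp: tangent_space_def)
next
  fix V
  assume "V \<in> tangent_space orbit \<eta>"
  then obtain \<gamma> where \<gamma>: "\<gamma> 0 = \<eta>" "\<forall>\<^sub>F t in nhds 0. \<gamma> t \<in> orbit" "(\<gamma> has_vector_derivative V) (at 0)"
    by (auto simp: tangent_space_def curve_at_def)
  have "((\<lambda>t. \<gamma> t ** \<gamma> t) has_vector_derivative \<eta> ** V + V ** \<eta>) (at 0)"
    using has_vector_derivative_matrix_mult[OF \<gamma>(3) \<gamma>(3)] \<gamma>(1) by simp
  then have "\<eta> ** V + V ** \<eta> = 0"
    by (rule has_vector_derivative_eventually_const[where c = "- mat 1"])
      (use \<gamma>(2) orbit_square in \<open>auto elim!: eventually_mono\<close>)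
  then have anti: "\<eta> ** V = - (V ** \<eta>)"
    by (simp add: eq_neg_iff_add_eq_0)
  \<comment> \<open>The orbit lies in the linear space sp, so its velocities do too.\<close>
  have "((\<lambda>t. transpose (\<gamma> t) - JJ ** \<gamma> t ** JJ) has_vector_derivative transpose V - JJ ** V ** JJ) (at 0)"
    by (auto intro!: derivative_eq_intros \<gamma>(3))
  then have "transpose V - JJ ** V ** JJ = 0"
    by (rule has_vector_derivative_eventually_const[where c = 0])
      (use \<gamma>(2) orbit_subset_sp_alg in \<open>auto elim!: eventually_mono simp: mem_sp_alg_iff\<close>)
  then have V: "transpose V = JJ ** V ** JJ"
    by simp
  have \<eta>: "transpose \<eta> = JJ ** \<eta> ** JJ"
    using assms orbit_subset_sp_alg mem_sp_alg_iff by blast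
  define \<xi> where "\<xi> = - ((1/2) *\<^sub>R (V ** \<eta>))"
  note bl = bounded_bilinear_matrix_mult
  \<comment> \<open>Transposition reverses the product and the inner J J contributes a sign, which
    anticommutation of V and \<eta> cancels. Hence V \<eta> lies in sp.\<close>
  have "transpose (V ** \<eta>) = JJ ** (V ** \<eta>) ** JJ"
    using anti by (simp add: matrix_transpose_mul V \<eta> matrix_mul_assoc mult_JJ_JJ neg_mult_left)
      (simp add: matrix_mul_assoc[symmetric] anti neg_mult_left neg_mult_right)
  then have "\<xi> \<in> sp_alg"
    by (simp add: \<xi>_def mem_sp_alg_iff transpose_scalar transpose_neg neg_mult_left neg_mult_right
        bounded_bilinear.scaleR_left[OF bl]
        bounded_bilinear.scaleR_right[OF bl])
  have "V ** \<eta> ** \<eta> = - V"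
    using orbit_square[OF assms] by (simp add: matrix_mul_assoc[symmetric] neg_mult_right)
  moreover have "\<eta> ** (V ** \<eta>) = V"
    using calculation by (simp add: matrix_mul_assoc anti neg_mult_left)
  \<comment> \<open>\<xi> \<eta> = V/2 and \<eta> \<xi> = -V/2, which accounts for the 1/2 in
    \<open>\<xi>\<close>.\<close>
  ultimately have "commutator \<xi> \<eta> = V"
    by (simp add: commutator_def \<xi>_def neg_mult_left neg_mult_right bounded_bilinear.scaleR_left[OF bl]
        bounded_bilinear.scaleR_right[OF bl] scaleR_2[symmetric] flip: scaleR_add_left)
  with \<open>\<xi> \<in> sp_alg\<close> show "V \<in> {commutator \<xi> \<eta> | \<xi>. \<xi> \<in> sp_alg}"
    by blast
qed

section \<open>Hamiltonian vector fields\<close>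

lemma inner_JJ_mult: "(JJ *v v) \<bullet> (JJ *v w) = v \<bullet> (w :: 'n::finite phase)"
proof -
  have "(JJ *v v) \<bullet> (JJ *v w) = (transpose JJ *v (JJ *v v)) \<bullet> w"
    by (metis dot_lmul_matrix transpose_matrix_vector)
  also have "\<dots> = v \<bullet> w"
    by (simp only: matrix_vector_mul_assoc transpose_JJ neg_mult_left JJ_square minus_minus
        matrix_vector_mul_lid)
  finally show ?thesis .
qed

lemma omega_nondegenerate:
  assumes "\<And>w. omega u w = omega v w"
  shows "u = v"
proof -
  have "JJ *v (- JJ *v x) = x" for x :: "'a phase"
    by (simp only: matrix_vector_mul_assoc neg_mult_right JJ_square minus_minus matrix_vector_mul_lid)
  \<comment> \<open>The choice w = -Jx makes J w = x, so \<open>omega\<close> recovers all inner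
    products.\<close>
  then have "u \<bullet> x = v \<bullet> x" for x
    using assms[of "- JJ *v x"] by (simp only: omega_JJ)
  then show ?thesis
    using vector_eq_rdot by blast
qed

lemma phase_hamiltonian:
  assumes "f differentiable (at z)"
  shows "\<exists>!X. is_hamiltonian_vector UNIV (\<lambda>z. omega) f z X"
    and "omega (X_phase f z) w = frechet_derivative f (at z) w"
proof -
  let ?f' = "frechet_derivative f (at z)"
  \<comment> \<open>J times the Euclidean gradient g: since J is orthogonal, (J g) . (J w) = g .
    w.\<close>
  define X where "X = JJ *v (\<chi> i. ?f' (axis i 1))"
  have f': "(f has_derivative ?f') (at z)"
    using assms by (simp add: frechet_derivative_works)
  have X: "omega X w = ?f' w" for w
  proof -
    have "omega X w = (\<chi> i. ?f' (axis i 1)) \<bullet> w"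
      by (simp only: omega_JJ X_def inner_JJ_mult)
    also have "\<dots> = (\<Sum>i\<in>UNIV. ?f' (w $ i *\<^sub>R axis i 1))"
      by (simp add: inner_vec_def linear_scale[OF has_derivative_linear[OF f']] mult.commute)
    also have "\<dots> = ?f' (\<Sum>i\<in>UNIV. w $ i *\<^sub>R axis i 1)"
      by (rule linear_sum[OF has_derivative_linear[OF f'], symmetric])
    also have "(\<Sum>i\<in>UNIV. w $ i *\<^sub>R axis i 1) = w"
      using basis_expansion[of w] by (simp add: scalar_mult_eq_scaleR)
    finally show ?thesis .
  qed
  have "is_hamiltonian_vector UNIV (\<lambda>z. omega) f z X"
    using has_tangent_value_of_has_derivative[OF f']
    by (simp add: is_hamiltonian_vector_def tangent_space_UNIV X)
  from hamiltonian_vf_eqI[OF this] X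
  show "\<exists>!X. is_hamiltonian_vector UNIV (\<lambda>z. omega) f z X"
    and "omega (X_phase f z) w = ?f' w"
    by (simp_all add: tangent_space_UNIV omega_nondegenerate X_phase_def)
qed

section \<open>The displayed Hamiltonians as instances of the corrected one\<close>

lemma laplacian_metric_GL:
  assumes "smooth H" and "E \<in> GL"
  shows "(\<lambda>y. H y + hbar / 4 * laplacian (metric_GL E) H y) = corrected hbar H (E ** transpose E)"
proof -
  have "invertible (E ** transpose E)"
    using assms(2) by (simp add: GL_def invertible_mult transpose_invertible)
  then show ?thesis
    by (simp add: fun_eq_iff laplacian_eq_trace[OF assms(1)] metric_GL_def matrix_inv_matrix_inv
        corrected_def)
qed

lemma laplacian_metric_orbit:
  assumes "smooth H" and "\<zeta> \<in> orbit"
  shows "(\<lambda>y. H y + hbar / 4 * laplacian (metric_orbit \<zeta>) H y) = corrected hbar H (\<zeta> ** JJ)"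
proof -
  \<comment> \<open>J J = -1 and \<zeta> \<zeta> = -1 cancel, so the metric matrix is J \<zeta>, and
    inverting it gives back \<zeta> J.\<close>
  have "\<zeta> ** JJ ** (JJ ** \<zeta>) = mat 1"
    using orbit_square[OF assms(2)] by (simp add: matrix_mul_assoc mult_JJ_JJ neg_mult_left)
  then have "invertible (\<zeta> ** JJ)"
    by (auto simp: invertible_right_inverse)
  then show ?thesis
    by (simp add: fun_eq_iff laplacian_eq_trace[OF assms(1)] metric_orbit_def matrix_inv_matrix_inv
        corrected_def)
qed

lemma H_GL_eq_corrected: "H_GL hbar H (z, E) = corrected hbar H (E ** transpose E) z"
  unfolding H_GL_def corrected_def by (simp add: trace_mul_sym[of E] matrix_mul_assoc)
    (metis trace_mul_sym matrix_mul_assoc)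

lemma H_orbit_eq_corrected: "H_orbit hbar H (z, \<zeta>) = corrected hbar H (\<zeta> ** JJ) z"
  by (simp add: H_orbit_def corrected_def)

lemma j_Sp_mult_JJ: "j_Sp E ** JJ = E ** transpose E"
  by (simp add: j_Sp_def neg_mult_left mult_JJ_JJ)

lemma GL_hamiltonian:
  fixes H :: "'n::finite phase \<Rightarrow> real" and z :: "'n phase" and E :: "'n pmat"
  assumes "hbar \<noteq> 0" and "smooth H" and "E \<in> GL"
  defines "X \<equiv> (X_phase (corrected hbar H (E ** transpose E)) z, JJ ** hessian H z ** E)"
  shows "\<exists>!Y. is_hamiltonian_vector (UNIV \<times> GL) (Omega_GL hbar) (H_GL hbar H) (z, E) Y"
    and "hamiltonian_vf (UNIV \<times> GL) (Omega_GL hbar) (H_GL hbar H) (z, E) = X"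
proof -
  let ?S = "E ** transpose E" and ?D = "hessian H z"
  let ?K' = "frechet_derivative (corrected hbar H ?S) (at z)"
  have T: "tangent_space (UNIV \<times> GL) (z, E) = UNIV"
    by (simp add: tangent_space_Times_UNIV tangent_space_GL[OF assms(3)])
  have D: "transpose ?D = ?D"
    by (rule transpose_hessian[OF assms(2)])
  have "((\<lambda>p. (fst p, snd p ** transpose (snd p))) has_derivative
      (\<lambda>p. (fst p, E ** transpose (snd p) + snd p ** transpose E))) (at (z, E))"
    by (auto intro!: derivative_eq_intros)
  from has_derivative_compose[OF this, of "\<lambda>(z, S). corrected hbar H S z"
      "\<lambda>(w, V). ?K' w + hbar / 4 * trace (V ** ?D)"] has_derivative_corrected[OF assms(2), of hbar ?S z]
  have H': "(H_GL hbar H has_derivative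
      (\<lambda>(w, W). ?K' w + hbar / 4 * trace ((E ** transpose W + W ** transpose E) ** ?D))) (at (z, E))"
    by (simp add: case_prod_unfold H_GL_eq_corrected[symmetric])
  have "Omega_GL hbar (z, E) X (w, W)
      = ?K' w + hbar / 4 * trace ((E ** transpose W + W ** transpose E) ** ?D)" for w W
  proof -
    \<comment> \<open>Transposition and cyclicity, with \<open>?D\<close> symmetric, match this term
      with the one from W E^T.\<close>
    have "trace (E ** transpose W ** ?D) = trace (transpose (E ** transpose W ** ?D))"
      by (simp add: trace_transpose)
    also have "\<dots> = trace ((?D ** W) ** transpose E)"
      by (simp add: matrix_transpose_mul D matrix_mul_assoc)
    also have "\<dots> = trace (transpose E ** ?D ** W)"
      by (metis trace_mul_sym matrix_mul_assoc)
    finally have "trace (E ** transpose W ** ?D) = trace (transpose E ** ?D ** W)" .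
    moreover have "trace (W ** transpose E ** ?D) = trace (transpose E ** ?D ** W)"
      by (metis trace_mul_sym matrix_mul_assoc)
    moreover have "transpose (JJ ** ?D ** E) ** JJ = transpose E ** ?D"
      by (simp add: matrix_transpose_mul D transpose_JJ matrix_mul_assoc neg_mult_left
          neg_mult_right mult_JJ_JJ)
    ultimately show ?thesis
      by (simp add: Omega_GL_def X_def phase_hamiltonian(2)[OF corrected_differentiable[OF assms(2)]]
          mult_add_left trace_add)
  qed
  then have ham: "is_hamiltonian_vector (UNIV \<times> GL) (Omega_GL hbar) (H_GL hbar H) (z, E) X"
    using has_tangent_value_of_has_derivative[OF H'] by (fastforce simp: is_hamiltonian_vector_def T)
  have "Y = X" if Y: "Y \<in> tangent_space (UNIV \<times> GL) (z, E)"
    and eq: "\<And>p. p \<in> tangent_space (UNIV \<times> GL) (z, E) \<Longrightarrow> Omega_GL hbar (z, E) Y p = Omega_GL hbar (z, E) X p" for Y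
  proof -
    have eq': "Omega_GL hbar (z, E) Y (w, W) = Omega_GL hbar (z, E) X (w, W)" for w W
      using eq by (simp add: T)
    let ?V = "snd Y - snd X"
    have "fst Y = fst X"
      using eq'[of _ 0] by (intro omega_nondegenerate) (simp add: Omega_GL_def case_prod_beta trace_0[simplified])
    moreover have "trace (transpose ?V ** JJ ** W) = 0" for W
      using eq'[of 0 W] \<open>fst Y = fst X\<close> assms(1)
      by (simp add: Omega_GL_def case_prod_beta transpose_diff mult_diff_left trace_sub)
    \<comment> \<open>This test vector cancels the J of the form and leaves the squared norm of
      \<open>?V\<close>.\<close>
    from this[of "- (JJ ** ?V)"] have "trace (transpose ?V ** ?V) = 0"
      by (simp add: neg_mult_right matrix_mul_assoc mult_JJ_JJ neg_mult_left)
    ultimately show ?thesis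
      by (simp add: trace_transpose_mult_self_eq_0_iff prod_eq_iff)
  qed
  from hamiltonian_vf_eqI[OF ham this]
  show "\<exists>!Y. is_hamiltonian_vector (UNIV \<times> GL) (Omega_GL hbar) (H_GL hbar H) (z, E) Y"
    and "hamiltonian_vf (UNIV \<times> GL) (Omega_GL hbar) (H_GL hbar H) (z, E) = X"
    by blast+
qed

lemma orbit_hamiltonian:
  fixes H :: "'n::finite phase \<Rightarrow> real" and z :: "'n phase" and \<zeta> :: "'n pmat"
  assumes "hbar \<noteq> 0" and "smooth H" and "\<zeta> \<in> orbit"
  defines "X \<equiv> (X_phase (corrected hbar H (\<zeta> ** JJ)) z, commutator (JJ ** hessian H z) \<zeta>)"
  shows "\<exists>!Y. is_hamiltonian_vector (UNIV \<times> orbit) (Omega_prod hbar) (H_orbit hbar H) (z, \<zeta>) Y"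
    and "hamiltonian_vf (UNIV \<times> orbit) (Omega_prod hbar) (H_orbit hbar H) (z, \<zeta>) = X"
proof -
  let ?D = "hessian H z"
  let ?K' = "frechet_derivative (corrected hbar H (\<zeta> ** JJ)) (at z)"
  have T: "tangent_space (UNIV \<times> orbit) (z, \<zeta>) = UNIV \<times> {commutator \<xi> \<zeta> | \<xi>. \<xi> \<in> sp_alg}"
    by (simp add: tangent_space_Times_UNIV tangent_space_orbit[OF assms(3)])
  have D: "JJ ** ?D \<in> sp_alg"
    by (rule JJ_symmetric_mem_sp_alg[OF transpose_hessian[OF assms(2)]])
  have \<zeta>: "\<zeta> \<in> sp_alg"
    using assms(3) orbit_subset_sp_alg by blast
  have "((\<lambda>p. (fst p, snd p ** JJ)) has_derivative (\<lambda>p. (fst p, snd p ** JJ))) (at (z, \<zeta>))"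
    by (auto intro!: derivative_eq_intros)
  from has_derivative_compose[OF this, of "\<lambda>(z, S). corrected hbar H S z"
      "\<lambda>(w, V). ?K' w + hbar / 4 * trace (V ** ?D)"] has_derivative_corrected[OF assms(2), of hbar "\<zeta> ** JJ" z]
  have H': "(H_orbit hbar H has_derivative
      (\<lambda>(w, W). ?K' w + hbar / 4 * trace (W ** JJ ** ?D))) (at (z, \<zeta>))"
    by (simp add: case_prod_unfold H_orbit_eq_corrected[symmetric])
  have "Omega_prod hbar (z, \<zeta>) X (w, commutator \<xi> \<zeta>)
      = ?K' w + hbar / 4 * trace (commutator \<xi> \<zeta> ** JJ ** ?D)" if "\<xi> \<in> sp_alg" for w \<xi>
  proof -
    \<comment> \<open>Invariance of the trace form moves the bracket onto \<zeta>, where it becomes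
      the tangent vector [\<xi>,\<zeta>].\<close>
    have "trace (\<zeta> ** commutator (JJ ** ?D) \<xi>) = trace (commutator \<xi> \<zeta> ** (JJ ** ?D))"
      by (simp add: commutator_swap[of "JJ ** ?D"] neg_mult_right trace_neg trace_commutator)
    then show ?thesis
      using that D
      by (simp add: Omega_prod_def X_def phase_hamiltonian(2)[OF corrected_differentiable[OF assms(2)]]
          Omega_orbit_commutator matrix_mul_assoc)
  qed
  then have ham: "is_hamiltonian_vector (UNIV \<times> orbit) (Omega_prod hbar) (H_orbit hbar H) (z, \<zeta>) X"
    using has_tangent_value_of_has_derivative[OF H'] D
    by (fastforce simp: is_hamiltonian_vector_def T X_def)
  have "Y = X" if Y: "Y \<in> tangent_space (UNIV \<times> orbit) (z, \<zeta>)"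
    and eq: "\<And>p. p \<in> tangent_space (UNIV \<times> orbit) (z, \<zeta>) \<Longrightarrow> Omega_prod hbar (z, \<zeta>) Y p = Omega_prod hbar (z, \<zeta>) X p" for Y
  proof -
    obtain \<kappa> where \<kappa>: "\<kappa> \<in> sp_alg" "snd Y = commutator \<kappa> \<zeta>"
      using Y by (auto simp: T)
    have eq': "omega (fst Y) w + hbar / 4 * trace (\<zeta> ** commutator \<kappa> \<xi>)
        = omega (fst X) w + hbar / 4 * trace (\<zeta> ** commutator (JJ ** ?D) \<xi>)" if "\<xi> \<in> sp_alg" for w \<xi>
      using eq[of "(w, commutator \<xi> \<zeta>)"] that \<kappa> D
      by (auto simp: T Omega_prod_def case_prod_beta X_def Omega_orbit_commutator)
    \<comment> \<open>The zero generator switches off the orbit part and isolates the phase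
      components.\<close>
    have "0 \<in> (sp_alg :: 'n pmat set)"
      by (simp add: sp_alg_def transpose_def vec_eq_iff matrix_matrix_mult_def)
    from eq'[OF this] have fst: "fst Y = fst X"
      by (intro omega_nondegenerate) (simp add: commutator_def)
    \<comment> \<open>By antisymmetry \<open>A\<close> is \<open>snd X - snd Y\<close>. Its
      transpose lies in sp and may serve as a generator; the difference of the two pairings is then
      a multiple of Tr(A A^T).\<close>
    define A where "A = commutator \<zeta> \<kappa> - commutator \<zeta> (JJ ** ?D)"
    have A: "transpose A \<in> sp_alg"
      using \<kappa>(1) D \<zeta> by (intro transpose_mem_sp_alg)
        (simp add: A_def mem_sp_alg_iff transpose_diff mult_diff_left mult_diff_right
          commutator_mem_sp_alg[unfolded mem_sp_alg_iff])
    have "trace (\<zeta> ** commutator \<kappa> (transpose A)) = trace (\<zeta> ** commutator (JJ ** ?D) (transpose A))"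
      using eq'[OF A, of 0] fst assms(1) by simp
    moreover have "trace (\<zeta> ** commutator \<xi> B) = trace (commutator \<zeta> \<xi> ** B)" for \<xi> B :: "'n pmat"
      by (simp add: trace_commutator commutator_swap[of \<zeta>] neg_mult_left trace_neg)
    ultimately have "trace (A ** transpose A) = 0"
      by (simp add: A_def mult_diff_left trace_sub)
    then have "A = 0"
      by (simp add: trace_mul_sym[of A] trace_transpose_mult_self_eq_0_iff)
    then have "snd Y = snd X"
      using \<kappa> by (simp add: A_def X_def commutator_swap[of \<zeta>])
    with fst show ?thesis
      by (simp add: prod_eq_iff)
  qed
  from hamiltonian_vf_eqI[OF ham this]
  show "\<exists>!Y. is_hamiltonian_vector (UNIV \<times> orbit) (Omega_prod hbar) (H_orbit hbar H) (z, \<zeta>) Y"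
    and "hamiltonian_vf (UNIV \<times> orbit) (Omega_prod hbar) (H_orbit hbar H) (z, \<zeta>) = X"
    by blast+
qed

theorem mainTheorem7:
  fixes hbar :: real and H :: "real^('n::finite + 'n) \<Rightarrow> real"
  assumes "hbar > 0" and "smooth H"
  shows
    "(\<forall>z. \<forall>E\<in>Sp. H_GL hbar H (z, E) = (H_orbit hbar H \<circ> map_prod id j_Sp) (z, E))
   \<and> has_hamiltonian_vf (UNIV \<times> GL) (Omega_GL hbar) (H_GL hbar H)
   \<and> (\<forall>E\<in>GL. has_hamiltonian_vf UNIV (\<lambda>z. omega)
         (\<lambda>y. H y + hbar / 4 * laplacian (metric_GL E) H y))
   \<and> (\<forall>z. \<forall>E\<in>GL. hamiltonian_vf (UNIV \<times> GL) (Omega_GL hbar) (H_GL hbar H) (z, E)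
         = (X_phase (\<lambda>y. H y + hbar / 4 * laplacian (metric_GL E) H y) z,
            JJ ** hessian H z ** E))
   \<and> has_hamiltonian_vf (UNIV \<times> orbit) (Omega_prod hbar) (H_orbit hbar H)
   \<and> (\<forall>\<zeta>\<in>orbit. has_hamiltonian_vf UNIV (\<lambda>z. omega)
         (\<lambda>y. H y + hbar / 4 * laplacian (metric_orbit \<zeta>) H y))
   \<and> (\<forall>z. \<forall>\<zeta>\<in>orbit. hamiltonian_vf (UNIV \<times> orbit) (Omega_prod hbar) (H_orbit hbar H) (z, \<zeta>)
         = (X_phase (\<lambda>y. H y + hbar / 4 * laplacian (metric_orbit \<zeta>) H y) z,
            commutator (JJ ** hessian H z) \<zeta>))
   \<and> (\<forall>z. \<forall>E\<in>Sp.
         hamiltonian_vf (UNIV \<times> GL) (Omega_GL hbar) (H_GL hbar H) (z, E)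
           \<in> tangent_space (UNIV \<times> Sp) (z, E)
       \<and> tangent_map (UNIV \<times> Sp) (map_prod id j_Sp) (z, E)
           (hamiltonian_vf (UNIV \<times> GL) (Omega_GL hbar) (H_GL hbar H) (z, E))
         = hamiltonian_vf (UNIV \<times> orbit) (Omega_prod hbar) (H_orbit hbar H)
             (map_prod id j_Sp (z, E)))"
proof (intro conjI allI ballI)
  have hbar: "hbar \<noteq> 0"
    using assms(1) by simp
  note H = assms(2)
  fix z :: "real^('n + 'n)" and E :: "real^('n + 'n)^('n + 'n)"
  {
    assume E: "E \<in> Sp"
    then have GL: "E \<in> GL" and orb: "j_Sp E \<in> orbit"
      using Sp_subset_GL j_Sp_image by auto
    let ?\<xi> = "JJ ** hessian H z"
    have \<xi>: "?\<xi> \<in> sp_alg"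
      by (rule JJ_symmetric_mem_sp_alg[OF transpose_hessian[OF H]])
    show "H_GL hbar H (z, E) = (H_orbit hbar H \<circ> map_prod id j_Sp) (z, E)"
      by (simp add: H_GL_eq_corrected H_orbit_eq_corrected j_Sp_mult_JJ)
    \<comment> \<open>The field was formed on \<open>GL\<close>. It is tangent to \<open>Sp\<close>
      because its generator lies in sp, and this tangency makes the value of
      \<open>tangent_map\<close> unique.\<close>
    show tangent: "hamiltonian_vf (UNIV \<times> GL) (Omega_GL hbar) (H_GL hbar H) (z, E)
        \<in> tangent_space (UNIV \<times> Sp) (z, E)"
      by (simp add: GL_hamiltonian(2)[OF hbar H GL] tangent_space_Times_UNIV
          mult_mem_tangent_space_Sp[OF \<xi> E])
    show "tangent_map (UNIV \<times> Sp) (map_prod id j_Sp) (z, E)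
          (hamiltonian_vf (UNIV \<times> GL) (Omega_GL hbar) (H_GL hbar H) (z, E))
        = hamiltonian_vf (UNIV \<times> orbit) (Omega_prod hbar) (H_orbit hbar H) (map_prod id j_Sp (z, E))"
    proof (rule tangent_map_eqI[OF _ tangent])
      have "has_tangent_value (UNIV \<times> Sp) (map_prod id j_Sp) (z, E) (v, ?\<xi> ** E)
          (v, commutator ?\<xi> (j_Sp E))" for v
        unfolding has_tangent_value_def
      proof (intro allI impI)
        fix \<gamma>
        assume \<gamma>: "curve_at (UNIV \<times> Sp) (z, E) (v, ?\<xi> ** E) \<gamma>"
        then have d: "((\<lambda>t. fst (\<gamma> t)) has_vector_derivative v) (at 0)"
          and "curve_at Sp E (?\<xi> ** E) (\<lambda>t. snd (\<gamma> t))"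
          by (auto simp: curve_at_def mem_Times_iff
              dest: bounded_linear.has_vector_derivative[OF bounded_linear_fst]
                bounded_linear.has_vector_derivative[OF bounded_linear_snd])
        then have "((\<lambda>t. j_Sp (snd (\<gamma> t))) has_vector_derivative commutator ?\<xi> (j_Sp E)) (at 0)"
          using has_tangent_value_j_Sp[OF \<xi>, of Sp E] by (auto simp: has_tangent_value_def comp_def)
        from has_derivative_Pair[OF d[unfolded has_vector_derivative_def]
            this[unfolded has_vector_derivative_def]]
        show "(map_prod id j_Sp \<circ> \<gamma> has_vector_derivative (v, commutator ?\<xi> (j_Sp E))) (at 0)"
          by (simp add: has_vector_derivative_def comp_def map_prod_def case_prod_beta)
      qed
      \<comment> \<open>The phase components on the two sides use E E^T and
        \<open>j_Sp E ** JJ\<close>. These agree, so the identity on phase space carries one to the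
        other.\<close>
      then show "has_tangent_value (UNIV \<times> Sp) (map_prod id j_Sp) (z, E)
          (hamiltonian_vf (UNIV \<times> GL) (Omega_GL hbar) (H_GL hbar H) (z, E))
          (hamiltonian_vf (UNIV \<times> orbit) (Omega_prod hbar) (H_orbit hbar H) (map_prod id j_Sp (z, E)))"
        by (simp add: GL_hamiltonian(2)[OF hbar H GL] orbit_hamiltonian(2)[OF hbar H orb] j_Sp_mult_JJ)
    qed
  }
  show "has_hamiltonian_vf (UNIV \<times> GL) (Omega_GL hbar) (H_GL hbar H)"
    "has_hamiltonian_vf (UNIV \<times> orbit) (Omega_prod hbar) (H_orbit hbar H)"
    using GL_hamiltonian(1)[OF hbar H] orbit_hamiltonian(1)[OF hbar H]
    by (auto simp: has_hamiltonian_vf_def)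
  {
    assume E: "E \<in> GL"
    show "has_hamiltonian_vf UNIV (\<lambda>z. omega) (\<lambda>y. H y + hbar / 4 * laplacian (metric_GL E) H y)"
      unfolding laplacian_metric_GL[OF H E] has_hamiltonian_vf_def
      by (intro ballI phase_hamiltonian(1) corrected_differentiable H)
    show "hamiltonian_vf (UNIV \<times> GL) (Omega_GL hbar) (H_GL hbar H) (z, E)
        = (X_phase (\<lambda>y. H y + hbar / 4 * laplacian (metric_GL E) H y) z, JJ ** hessian H z ** E)"
      unfolding laplacian_metric_GL[OF H E] by (rule GL_hamiltonian(2)[OF hbar H E])
  }
  {
    \<comment> \<open>The fixed matrix \<open>E\<close> now stands for the orbit point
      \<zeta>.\<close>
    assume E: "E \<in> orbit"
    show "has_hamiltonian_vf UNIV (\<lambda>z. omega) (\<lambda>y. H y + hbar / 4 * laplacian (metric_orbit E) H y)"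
      unfolding laplacian_metric_orbit[OF H E] has_hamiltonian_vf_def
      by (intro ballI phase_hamiltonian(1) corrected_differentiable H)
    show "hamiltonian_vf (UNIV \<times> orbit) (Omega_prod hbar) (H_orbit hbar H) (z, E)
        = (X_phase (\<lambda>y. H y + hbar / 4 * laplacian (metric_orbit E) H y) z,
           commutator (JJ ** hessian H z) E)"
      unfolding laplacian_metric_orbit[OF H E] by (rule orbit_hamiltonian(2)[OF hbar H E])
  }
qed

end
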